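(* For every $\ell\geq 3$, the graph $K^{\triangle}_\ell$ is word-representable.
   Context: Two distinct letters $x,y$ alternate in a word $w$ if deleting all letters of $w$ other than the copies of $x$ and $y$ leaves a word $xyxy\cdots$ or $yxyx\cdots$ (of even or odd length). A graph $G=(V,E)$ (finite, simple) is word-representable if there is a word $w$ over the alphabet $V$, containing each letter of $V$, such that for all distinct $x,y\in V$, $x$ and $y$ alternate in $w$ if and only if $xy\in E$. $K^{\triangle}_\ell$ ($\ell\geq 3$): the graph obtained from the complete graph on $\{1,\ldots,\ell\}$ by adding, for each $i\in\{1,\ldots,\ell-1\}$, a vertex $i'$ adjacent exactly to $i$ and $i+1$, and a vertex $\ell'$ adjacent exactly to $1$ and $\ell$. *)

theory Defs
  imports "Graph_Theory.Pair_Digraph"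
begin

text \<open>
  A finite simple graph is a \<^locale>\<open>pair_graph\<close>: finite, loop-free, and with a symmetric arc
  relation, so that the edge \<open>xy\<close> is present iff \<open>(x, y) \<in> parcs G\<close>.
\<close>

definition alternating_word :: "'a \<Rightarrow> 'a \<Rightarrow> nat \<Rightarrow> 'a list" where
  "alternating_word x y n = map (\<lambda>i. if even i then x else y) [0..<n]"

definition alternate_in :: "'a \<Rightarrow> 'a \<Rightarrow> 'a list \<Rightarrow> bool" where
  "alternate_in x y w \<longleftrightarrow> x \<noteq> y \<and>
     (\<exists>n. filter (\<lambda>z. z \<in> {x, y}) w = alternating_word x y n \<or>
          filter (\<lambda>z. z \<in> {x, y}) w = alternating_word y x n)"

definition word_representable :: "'a pair_pre_digraph \<Rightarrow> bool" where
  "word_representable G \<longleftrightarrow>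
     (\<exists>w. set w = pverts G \<and>
        (\<forall>x\<in>pverts G. \<forall>y\<in>pverts G. x \<noteq> y \<longrightarrow>
           (alternate_in x y w \<longleftrightarrow> (x, y) \<in> parcs G)))"

text \<open>\<open>Inner i\<close> is the vertex \<open>i\<close> of the complete graph, \<open>Outer i\<close> the added vertex \<open>i'\<close>.\<close>

datatype ktri_vertex = Inner nat | Outer nat

definition K_triangle_edges :: "nat \<Rightarrow> (ktri_vertex \<times> ktri_vertex) set" where
  "K_triangle_edges l =
     {(Inner i, Inner j) | i j. i \<in> {1..l} \<and> j \<in> {1..l} \<and> i \<noteq> j}
     \<union> {(Outer i, Inner i) | i. i \<in> {1..l - 1}}
     \<union> {(Outer i, Inner (i + 1)) | i. i \<in> {1..l - 1}}
     \<union> {(Outer l, Inner 1), (Outer l, Inner l)}"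

definition K_triangle :: "nat \<Rightarrow> ktri_vertex pair_pre_digraph" where
  "K_triangle l =
     \<lparr> pverts = Inner ` {1..l} \<union> Outer ` {1..l},
       parcs = K_triangle_edges l \<union> (K_triangle_edges l)\<inverse> \<rparr>"

lemma pair_graph_K_triangle:
  assumes "l \<ge> 3"
  shows "pair_graph (K_triangle l)"
proof
  show "fst e \<in> pverts (K_triangle l)" if "e \<in> parcs (K_triangle l)" for e
    using that assms by (auto simp: K_triangle_def K_triangle_edges_def)
  show "snd e \<in> pverts (K_triangle l)" if "e \<in> parcs (K_triangle l)" for e
    using that assms by (auto simp: K_triangle_def K_triangle_edges_def)
  show "fst e \<noteq> snd e" if "e \<in> parcs (K_triangle l)" for e
    using that by (auto simp: K_triangle_def K_triangle_edges_def)
  show "finite (pverts (K_triangle l))"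
    by (simp add: K_triangle_def)
  have "parcs (K_triangle l) \<subseteq> pverts (K_triangle l) \<times> pverts (K_triangle l)"
    using assms by (auto simp: K_triangle_def K_triangle_edges_def)
  then show "finite (parcs (K_triangle l))"
    by (rule finite_subset) (simp add: K_triangle_def)
  show "symmetric (K_triangle l)"
    unfolding symmetric_def
    by (auto simp: K_triangle_def sym_Un_converse arcs_ends_def arc_to_ends_def)
qed

end

theory Submission
  imports Defs
begin

text \<open>
  The representing word consists of three copies of \<open>1 2 \<dots> l\<close>, which make the inner vertices pairwise
  alternate, with the outer letters inserted.  In the middle copy each \<open>i'\<close> with \<open>i < l\<close> encloses
  exactly \<open>i\<close> and \<open>i + 1\<close>, so it repeats with respect to every other inner letter.  Appending the
  outer letters in descending order destroys the alternation of \<open>i'\<close> with \<open>(i + 1)'\<close>.  The letter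
  \<open>l'\<close> occurs right after \<open>1\<close>, right before \<open>l\<close> and right after \<open>1\<close> in the three copies; an additional
  \<open>(l - 1)'\<close> after its first occurrence separates it from \<open>(l - 1)'\<close>.
\<close>

section \<open>Alternation as absence of equal neighbours\<close>

lemma alternating_word_0: "alternating_word x y 0 = []"
  by (simp add: alternating_word_def)

lemma alternating_word_Suc: "alternating_word x y (Suc n) = x # alternating_word y x n"
  by (simp add: alternating_word_def upt_conv_Cons map_Suc_upt[symmetric] o_def
      del: upt_Suc map_Suc_upt)

lemma distinct_adj_alternating_word:
  assumes "x \<noteq> y"
  shows "distinct_adj (alternating_word x y n)"
  using assms
proof (induction n arbitrary: x y)
  case (Suc n)
  then show ?case
    by (cases n) (auto simp: alternating_word_0 alternating_word_Suc)
qed (simp add: alternating_word_0)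

lemma distinct_adj_imp_alternating_word:
  assumes "distinct_adj (z # xs)" "set (z # xs) \<subseteq> {x, y}" "z = x" "x \<noteq> y"
  shows "\<exists>n. z # xs = alternating_word x y n"
  using assms
proof (induction xs arbitrary: x y z)
  case Nil
  then show ?case
    by (intro exI[of _ "Suc 0"]) (simp add: alternating_word_0 alternating_word_Suc)
next
  case (Cons a xs)
  \<comment> \<open>Having no equal neighbours forces \<open>a = y\<close>, so the roles of
    \<open>x\<close> and \<open>y\<close> swap.\<close>
  then have "\<exists>n. a # xs = alternating_word y x n"
    by (intro Cons.IH) auto
  then show ?case
    using Cons.prems alternating_word_Suc by metis
qed

text \<open>Over two letters, each letter is determined by its predecessor once equal neighbours are
  excluded. This replaces the search for \<open>n\<close> by a check on the restricted word.\<close>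

lemma alternate_in_iff_distinct_adj:
  "alternate_in x y w \<longleftrightarrow> x \<noteq> y \<and> distinct_adj (filter (\<lambda>z. z \<in> {x, y}) w)"
proof -
  have "\<exists>n. v = alternating_word x y n \<or> v = alternating_word y x n"
    if "distinct_adj v" "set v \<subseteq> {x, y}" "x \<noteq> y" for v
  proof (cases v)
    case Nil
    then show ?thesis by (metis alternating_word_0)
  next
    case (Cons a as)
    then show ?thesis
      using that distinct_adj_imp_alternating_word[of a as x y]
        distinct_adj_imp_alternating_word[of a as y x] by auto
  qed
  moreover have "set (filter (\<lambda>z. z \<in> {x, y}) w) \<subseteq> {x, y}"
    by auto
  ultimately show ?thesis
    unfolding alternate_in_def by (metis distinct_adj_alternating_word)
qed

lemma alternate_in_commute: "alternate_in x y w \<longleftrightarrow> alternate_in y x w"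
  by (auto simp: alternate_in_iff_distinct_adj insert_commute)

text \<open>The restriction to the two letters contains \<open>x x\<close>. Each non-edge below is
  certified by exhibiting such a gap \<open>v\<close>.\<close>

lemma not_alternate_in_if_repeated:
  assumes "w = u @ x # v @ x # t" "x \<notin> set v" "y \<notin> set v"
  shows "\<not> alternate_in x y w"
proof -
  have "filter (\<lambda>z. z \<in> {x, y}) v = []"
    using assms by (auto simp: filter_empty_conv)
  then show ?thesis
    using assms by (simp add: alternate_in_iff_distinct_adj distinct_adj_append_iff)
qed

lemma alternate_in_removeAll:
  assumes "x \<noteq> a" "y \<noteq> a"
  shows "alternate_in x y (removeAll a w) \<longleftrightarrow> alternate_in x y w"
proof -
  have "filter (\<lambda>z. z \<in> {x, y}) (removeAll a w) = filter (\<lambda>z. z \<in> {x, y}) w"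
    using assms by (induction w) auto
  then show ?thesis
    by (simp only: alternate_in_iff_distinct_adj)
qed

section \<open>The representing word and its runs\<close>

definition inner_run :: "nat \<Rightarrow> nat \<Rightarrow> ktri_vertex list" where
  "inner_run a b = map Inner [a..<b]"

text \<open>Block \<open>i\<close> opens the segment of \<open>i'\<close> and closes that of
  \<open>(i - 1)'\<close>, so consecutive segments overlap.\<close>

definition middle_run :: "nat \<Rightarrow> nat \<Rightarrow> ktri_vertex list" where
  "middle_run a b = concat (map (\<lambda>i. [Outer i, Inner i, Outer (i - 1)]) [a..<b])"

definition outer_run :: "nat \<Rightarrow> nat \<Rightarrow> ktri_vertex list" where
  "outer_run a b = map Outer (rev [a..<b])"

text \<open>The first block of the middle copy contributes a spurious letter \<open>Outer 0\<close>, removed at the end.\<close>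

definition ktri_word :: "nat \<Rightarrow> ktri_vertex list" where
  "ktri_word l =
     [Inner 1, Outer l, Outer (l - 1)] @ inner_run 2 (l + 1) @ middle_run 1 (l + 1) @
     [Inner 1, Outer l] @ inner_run 2 (l + 1) @ outer_run 1 l"

lemma set_inner_run [simp]: "set (inner_run a b) = Inner ` {a..<b}"
  by (simp add: inner_run_def)

lemma set_outer_run [simp]: "set (outer_run a b) = Outer ` {a..<b}"
  by (simp add: outer_run_def)

lemma Inner_in_set_middle_run [simp]: "Inner j \<in> set (middle_run a b) \<longleftrightarrow> a \<le> j \<and> j < b"
  by (auto simp: middle_run_def)

text \<open>The bound is on \<open>Suc j\<close> because the first block already closes with
  \<open>Outer (a - 1)\<close>; \<open>a < b\<close> excludes the empty run.\<close>

lemma Outer_in_set_middle_run [simp]: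
  assumes "0 < a"
  shows "Outer j \<in> set (middle_run a b) \<longleftrightarrow> a \<le> Suc j \<and> j < b \<and> a < b"
proof
  assume "a \<le> Suc j \<and> j < b \<and> a < b"
  then have "a \<le> j \<and> j < b \<or> a \<le> Suc j \<and> Suc j < b"
    by linarith
  then show "Outer j \<in> set (middle_run a b)"
    unfolding middle_run_def by (auto intro: bexI[of _ j] bexI[of _ "Suc j"])
qed (use assms in \<open>auto simp: middle_run_def\<close>)

section \<open>Splitting runs at a letter\<close>

lemma upt_split:
  assumes "a \<le> i" "i < b"
  shows "[a..<b] = [a..<i] @ i # [Suc i..<b]"
  using assms by (metis le_add_diff_inverse less_imp_le_nat upt_add_eq_append upt_conv_Cons)

lemma inner_run_split:
  "a \<le> i \<Longrightarrow> i < b \<Longrightarrow> inner_run a b = inner_run a i @ Inner i # inner_run (Suc i) b"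
  unfolding inner_run_def by (subst upt_split[of a i b]) auto

lemma outer_run_split:
  "a \<le> i \<Longrightarrow> i < b \<Longrightarrow> outer_run a b = outer_run (Suc i) b @ Outer i # outer_run a i"
  unfolding outer_run_def by (subst upt_split[of a i b]) auto

lemma middle_run_split:
  "a \<le> i \<Longrightarrow> i < b \<Longrightarrow>
    middle_run a b = middle_run a i @ [Outer i, Inner i, Outer (i - 1)] @ middle_run (Suc i) b"
  unfolding middle_run_def by (subst upt_split[of a i b]) auto

text \<open>Exposes both occurrences of \<open>Outer i\<close>, which lie in two consecutive
  blocks.\<close>

lemma middle_run_split2:
  assumes "a \<le> i" "Suc i < b"
  shows "middle_run a b = middle_run a i @
    [Outer i, Inner i, Outer (i - 1), Outer (Suc i), Inner (Suc i), Outer i] @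
    middle_run (Suc (Suc i)) b"
  using assms middle_run_split[of a i b] middle_run_split[of "Suc i" "Suc i" b]
  by (simp add: middle_run_def)

lemma filter_none: "x \<notin> set v \<Longrightarrow> y \<notin> set v \<Longrightarrow> filter (\<lambda>z. z = x \<or> z = y) v = []"
  by (auto simp: filter_empty_conv)


section \<open>Pairs that alternate\<close>

lemma alternate_in_ktri_word_Inner_Inner:
  assumes "1 \<le> i" "i < j" "j \<le> l"
  shows "alternate_in (Inner i) (Inner j) (ktri_word l)"
proof -
  let ?P = "\<lambda>z. z = Inner i \<or> z = Inner j"
  have m: "filter ?P (middle_run 1 (Suc l)) = [Inner i, Inner j]"
    using assms by (simp add: middle_run_split[of "Suc 0" i "Suc l"] middle_run_split[of "Suc i" j "Suc l"]
        filter_none image_iff)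
  have j: "filter ?P (inner_run (Suc i) (Suc l)) = [Inner j]"
    using assms by (simp add: inner_run_split[of "Suc i" j "Suc l"] filter_none image_iff)
  \<comment> \<open>In the first and third copies \<open>Inner 1\<close> is written separately, so
    the run starts at 2.\<close>
  have "filter ?P (inner_run 2 (Suc l)) = (if i = 1 then [Inner j] else [Inner i, Inner j])"
    using assms j by (cases "i = 1")
      (auto simp: inner_run_split[of 2 i "Suc l"] inner_run_split[of 2 j "Suc l"] filter_none image_iff)
  with m show ?thesis
    using assms by (auto simp: alternate_in_iff_distinct_adj ktri_word_def filter_none image_iff)
qed

text \<open>The restriction is \<open>j i' j i' j i'\<close>, with one more \<open>i'\<close> in
  front if \<open>i = l - 1\<close>. In that case \<open>l \<ge> 3\<close> gives
  \<open>j \<ge> 2\<close>, so the extra letter does precede the first \<open>j\<close>.\<close>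

lemma alternate_in_ktri_word_Outer_Inner:
  assumes "l \<ge> 3" "1 \<le> i" "i < l" "j = i \<or> j = Suc i"
  shows "alternate_in (Outer i) (Inner j) (ktri_word l)"
proof -
  let ?P = "\<lambda>z. z = Outer i \<or> z = Inner j"
  have m: "filter ?P (middle_run 1 (Suc l)) = [Outer i, Inner j, Outer i]"
    using assms by (auto simp: middle_run_split2[of "Suc 0" i "Suc l"] filter_none image_iff)
  have o: "filter ?P (outer_run 1 l) = [Outer i]"
    using assms by (simp add: outer_run_split[of "Suc 0" i l] filter_none image_iff)
  have "filter ?P (inner_run 2 (Suc l)) = (if j = 1 then [] else [Inner j])"
    using assms by (auto simp: inner_run_split[of 2 j "Suc l"] filter_none image_iff)
  with m o show ?thesis
    using assms by (auto simp: alternate_in_iff_distinct_adj ktri_word_def)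
qed

lemma alternate_in_ktri_word_Outer_last:
  assumes "l \<ge> 2" "j = 1 \<or> j = l"
  shows "alternate_in (Outer l) (Inner j) (ktri_word l)"
proof -
  let ?P = "\<lambda>z. z = Outer l \<or> z = Inner j"
  \<comment> \<open>There is no block \<open>l + 1\<close> to close the segment of
    \<open>l'\<close>, so \<open>l'\<close> occurs only once here.\<close>
  have m: "filter ?P (middle_run 1 (Suc l)) = (if j = 1 then [Inner j, Outer l] else [Outer l, Inner j])"
  proof (cases "j = 1")
    case True
    then show ?thesis
      using assms by (simp add: middle_run_split[of "Suc 0" "Suc 0" "Suc l"] middle_run_split[of "Suc (Suc 0)" l "Suc l"]
          filter_none image_iff middle_run_def[of "Suc 0" "Suc 0"] middle_run_def[of "Suc l" "Suc l"])
  next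
    case False
    then show ?thesis
      using assms by (auto simp: middle_run_split[of "Suc 0" l "Suc l"] filter_none image_iff)
  qed
  have o: "filter ?P (outer_run 1 l) = []"
    by (auto simp: filter_none image_iff)
  have "filter ?P (inner_run 2 (Suc l)) = (if j = 1 then [] else [Inner j])"
    using assms by (auto simp: inner_run_split[of 2 l "Suc l"]
          inner_run_def[of "Suc l" "Suc l"] filter_none image_iff)
  with m o show ?thesis
    using assms by (auto simp: alternate_in_iff_distinct_adj ktri_word_def)
qed

section \<open>Pairs that do not alternate\<close>

text \<open>The gap between the two occurrences of \<open>i'\<close> in the middle copy consists of
  exactly the four excluded letters.\<close>

lemma not_alternate_in_ktri_word_Outer:
  assumes "1 \<le> i" "i < l" "y \<notin> {Inner i, Inner (Suc i), Outer (i - 1), Outer (Suc i)}"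
  shows "\<not> alternate_in (Outer i) y (ktri_word l)"
proof (rule not_alternate_in_if_repeated)
  show "ktri_word l =
      ([Inner 1, Outer l, Outer (l - 1)] @ inner_run 2 (l + 1) @ middle_run 1 i) @
      Outer i # [Inner i, Outer (i - 1), Outer (Suc i), Inner (Suc i)] @
      Outer i # middle_run (Suc (Suc i)) (l + 1) @
      [Inner 1, Outer l] @ inner_run 2 (l + 1) @ outer_run 1 l"
    using assms by (simp add: ktri_word_def middle_run_split2[of "Suc 0" i "Suc l"])
qed (use assms in auto)

text \<open>The gap runs from the last \<open>(i + 1)'\<close> of the middle copy to the one in the
  final run, where descending order puts \<open>i'\<close> later. That run stops at
  \<open>(l - 1)'\<close>, hence \<open>Suc i < l\<close>.\<close>

lemma not_alternate_in_ktri_word_Outer_Suc: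
  assumes "1 \<le> i" "Suc i < l"
  shows "\<not> alternate_in (Outer (Suc i)) (Outer i) (ktri_word l)"
proof (rule not_alternate_in_if_repeated)
  let ?j = "Suc i"
  show "ktri_word l =
      ([Inner 1, Outer l, Outer (l - 1)] @ inner_run 2 (l + 1) @ middle_run 1 ?j @
       [Outer ?j, Inner ?j, Outer i, Outer (Suc ?j), Inner (Suc ?j)]) @
      Outer ?j #
      (middle_run (Suc (Suc ?j)) (l + 1) @ [Inner 1, Outer l] @ inner_run 2 (l + 1) @
       outer_run (Suc ?j) l) @
      Outer ?j # outer_run 1 ?j"
    using assms
    by (simp add: ktri_word_def middle_run_split2[of "Suc 0" ?j "Suc l"] outer_run_split[of "Suc 0" ?j l])
qed (use assms in auto)

text \<open>The gap runs from the additional \<open>(l - 1)'\<close> to the opening of block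
  \<open>l - 1\<close>; the next \<open>l'\<close> comes only in block \<open>l\<close>.\<close>

lemma not_alternate_in_ktri_word_Outer_last_Outer:
  assumes "l \<ge> 2"
  shows "\<not> alternate_in (Outer (l - 1)) (Outer l) (ktri_word l)"
proof (rule not_alternate_in_if_repeated)
  show "ktri_word l =
      [Inner 1, Outer l] @ Outer (l - 1) # (inner_run 2 (l + 1) @ middle_run 1 (l - 1)) @
      Outer (l - 1) # [Inner (l - 1), Outer (l - 2)] @ middle_run l (l + 1) @
      [Inner 1, Outer l] @ inner_run 2 (l + 1) @ outer_run 1 l"
    using assms by (simp add: ktri_word_def middle_run_split[of "Suc 0" "l - Suc 0" "Suc l"] numeral_2_eq_2)
qed (use assms in auto)

text \<open>Here the inner letter repeats: between its first two occurrences there is no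
  \<open>l'\<close>, which stands before the first \<open>2\<close> and then only in block
  \<open>l\<close>.\<close>

lemma not_alternate_in_ktri_word_Outer_last_Inner:
  assumes "1 < j" "j < l"
  shows "\<not> alternate_in (Inner j) (Outer l) (ktri_word l)"
proof (rule not_alternate_in_if_repeated)
  show "ktri_word l =
      ([Inner 1, Outer l, Outer (l - 1)] @ inner_run 2 j) @ Inner j #
      (inner_run (Suc j) (l + 1) @ middle_run 1 j @ [Outer j]) @ Inner j #
      Outer (j - 1) # middle_run (Suc j) (l + 1) @
      [Inner 1, Outer l] @ inner_run 2 (l + 1) @ outer_run 1 l"
    using assms
    by (simp add: ktri_word_def middle_run_split[of "Suc 0" j "Suc l"] inner_run_split[of 2 j "Suc l"])
qed (use assms in auto)

section \<open>Comparison with the edges of the graph\<close>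

lemma alternate_in_ktri_word_Outer_Inner_iff:
  assumes "l \<ge> 3" "i \<in> {1..l}" "j \<in> {1..l}"
  shows "alternate_in (Outer i) (Inner j) (ktri_word l) \<longleftrightarrow>
    (if i = l then j \<in> {1, l} else j \<in> {i, Suc i})"
proof (cases "i = l")
  case True
  show ?thesis
  proof (cases "j \<in> {1, l}")
    case True
    then show ?thesis
      using assms \<open>i = l\<close> alternate_in_ktri_word_Outer_last[of l j] by auto
  next
    case False
    then have "1 < j" "j < l"
      using assms by auto
    then show ?thesis
      using False \<open>i = l\<close> not_alternate_in_ktri_word_Outer_last_Inner
        alternate_in_commute[of "Outer l" "Inner j"] by simp
  qed
next
  case False
  then have "1 \<le> i" "i < l"
    using assms by auto
  then show ?thesis
    using False alternate_in_ktri_word_Outer_Inner[OF assms(1)]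
      not_alternate_in_ktri_word_Outer[of i l "Inner j"]
    by (cases "j \<in> {i, Suc i}") auto
qed

lemma not_alternate_in_ktri_word_Outer_Outer:
  assumes "1 \<le> i" "i < j" "j \<le> l"
  shows "\<not> alternate_in (Outer i) (Outer j) (ktri_word l)"
\<comment> \<open>Since \<open>i < j\<close>, only \<open>j = Suc i\<close> puts \<open>j'\<close>
  inside the segment of \<open>i'\<close>.\<close>
proof (cases "j = Suc i")
  case True
  then show ?thesis
    using assms not_alternate_in_ktri_word_Outer_Suc[of i l]
      not_alternate_in_ktri_word_Outer_last_Outer[of l]
      alternate_in_commute[of "Outer i" "Outer j"]
    by (cases "j = l") auto
next
  case False
  then show ?thesis
    using assms by (intro not_alternate_in_ktri_word_Outer) auto
qed

lemma set_ktri_word: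
  assumes "l \<ge> 3"
  shows "set (removeAll (Outer 0) (ktri_word l)) = pverts (K_triangle l)"
proof (rule set_eqI)
  show "z \<in> set (removeAll (Outer 0) (ktri_word l)) \<longleftrightarrow> z \<in> pverts (K_triangle l)" for z
    using assms by (cases z) (auto simp: ktri_word_def K_triangle_def)
qed

theorem theorem9:
  fixes l :: nat
  assumes "l \<ge> 3"
  shows "word_representable (K_triangle l)"
proof -
  have "alternate_in x y (ktri_word l) \<longleftrightarrow> (x, y) \<in> parcs (K_triangle l)"
    if "x \<in> pverts (K_triangle l)" "y \<in> pverts (K_triangle l)" "x \<noteq> y" for x y
  proof -
    have inn: "(Inner i, Inner j) \<in> parcs (K_triangle l)"
      if "i \<in> {1..l}" "j \<in> {1..l}" "i \<noteq> j" for i j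
      using that by (auto simp: K_triangle_def K_triangle_edges_def)
    have out: "(Outer i, Outer j) \<notin> parcs (K_triangle l)" for i j
      by (auto simp: K_triangle_def K_triangle_edges_def)
    have mix: "(Outer i, Inner j) \<in> parcs (K_triangle l) \<longleftrightarrow>
        (if i = l then j \<in> {1, l} else j \<in> {i, Suc i})" if "i \<in> {1..l}" for i j
      using that assms by (auto simp: K_triangle_def K_triangle_edges_def)
    have sym: "(Inner j, Outer i) \<in> parcs (K_triangle l) \<longleftrightarrow>
        (Outer i, Inner j) \<in> parcs (K_triangle l)" for i j
      by (auto simp: K_triangle_def)
    have vert: "z \<in> pverts (K_triangle l) \<longleftrightarrow>
        (case z of Inner i \<Rightarrow> i \<in> {1..l} | Outer i \<Rightarrow> i \<in> {1..l})" for z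
      by (auto simp: K_triangle_def split: ktri_vertex.split)
    show ?thesis
    proof (cases x)
      case x: (Inner i)
      show ?thesis
      proof (cases y)
        case y: (Inner j)
        have "alternate_in x y (ktri_word l)"
          using that x y alternate_in_ktri_word_Inner_Inner[of i j l]
            alternate_in_ktri_word_Inner_Inner[of j i l] alternate_in_commute[of x y]
          by (cases "i < j") (auto simp: vert)
        then show ?thesis
          using that x y inn by (auto simp: vert)
      next
        case y: (Outer j)
        then show ?thesis
          using that x assms alternate_in_commute[of x y]
          by (simp add: vert mix sym alternate_in_ktri_word_Outer_Inner_iff)
      qed
    next
      case x: (Outer i)
      show ?thesis
      proof (cases y)
        case y: (Inner j)
        then show ?thesis
          using that x assms by (simp add: vert mix alternate_in_ktri_word_Outer_Inner_iff)
      next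
        case y: (Outer j)
        have "\<not> alternate_in x y (ktri_word l)"
          using that x y not_alternate_in_ktri_word_Outer_Outer[of i j l]
            not_alternate_in_ktri_word_Outer_Outer[of j i l] alternate_in_commute[of x y]
          by (cases "i < j") (auto simp: vert)
        then show ?thesis
          using out x y by auto
      qed
    qed
  qed
  \<comment> \<open>Hence deleting the spurious letter changes no alternation between
    vertices.\<close>
  moreover have "z \<noteq> Outer 0" if "z \<in> pverts (K_triangle l)" for z
    using that by (auto simp: K_triangle_def)
  ultimately show ?thesis
    unfolding word_representable_def
    using set_ktri_word[OF assms] by (intro exI[of _ "removeAll (Outer 0) (ktri_word l)"])
      (simp add: alternate_in_removeAll)
qed

end
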